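(* Let $G$ be a graph and $v$ a vertex of $G$. The map $\Phi:\Pi_v^v(G)\to D(G)$ given by $[\gamma]\mapsto\psi_\gamma$ is an isomorphism of groups.
   Context: All graphs are undirected, have no multiple edges, may have loops, are connected, and are not a single isolated vertex. A walk is a sequence $(v_0\cdots v_n)$ with $v_i\sim v_{i+1}$. A prune of a walk with $v_i=v_{i+2}$ replaces the segment $v_iv_{i+1}v_i$ by $v_i$. A spider move on $(v_0\cdots v_n)$ replaces one vertex $v_i$, $0<i<n$, by $v_i'$ with $v_{i-1}\sim v_i'\sim v_{i+1}$. Walks are equivalent if connected by finitely many prunes, inverse prunes and spider moves. The fundamental groupoid $\Pi(G)$ has objects the vertices and arrows $v\to w$ the equivalence classes of walks from $v$ to $w$, composed by concatenation ($\alpha*\beta$ is $\alpha$ followed by $\beta$); $\Pi_v(G)$ is the set of arrows with source $v$, and $\Pi_v^v(G)$ is the group of arrows from $v$ to $v$. The universal homotopy cover $U=U_vG$ is the graph whose vertices are the arrows in $\Pi_v(G)$, with $\alpha\sim\beta$ iff $\beta=\alpha*[(wx)]$ for an edge $w\sim x$ with $w$ the target of $\alpha$; $\rho:U\to G$ sends an arrow to its target. $D(G)$ is the group (under composition) of graph automorphisms $\varphi$ of $U$ with $\rho\circ\varphi=\rho$ (deck transformations). For $\gamma\in\Pi_v^v(G)$, $\psi_\gamma:U\to U$ is $\psi_\gamma(\alpha)=\gamma*\alpha$. *)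

theory Defs
  imports
    "HOL-Algebra.Bij"
    "Graph_Theory.Pair_Digraph"
    "Graph_Theory.Vertex_Walk"
    "Graph_Theory.Digraph_Component"
begin

text \<open>
  An undirected graph without multiple edges, possibly with loops and possibly infinite, is a
  \<^locale>\<open>pair_sym_digraph\<close>: \<open>parcs G\<close> is a symmetric adjacency relation on \<open>pverts G\<close>.
  A walk \<open>(v\<^sub>0 \<dots> v\<^sub>n)\<close> with \<open>n \<ge> 0\<close> is a \<^const>\<open>vwalk\<close>, a nonempty list of vertices.
\<close>

inductive walk_move :: "'a pair_pre_digraph \<Rightarrow> 'a vwalk \<Rightarrow> 'a vwalk \<Rightarrow> bool"
  for G :: "'a pair_pre_digraph"
where
  prune: "vwalk (p @ [a, b, a] @ q) G \<Longrightarrow> walk_move G (p @ [a, b, a] @ q) (p @ [a] @ q)"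
| spider: "vwalk (p @ [a, b, c] @ q) G \<Longrightarrow> (a, b') \<in> parcs G \<Longrightarrow> (b', c) \<in> parcs G \<Longrightarrow>
    walk_move G (p @ [a, b, c] @ q) (p @ [a, b', c] @ q)"

definition walk_equiv :: "'a pair_pre_digraph \<Rightarrow> 'a vwalk \<Rightarrow> 'a vwalk \<Rightarrow> bool" where
  "walk_equiv G p q \<longleftrightarrow> vwalk p G \<and> vwalk q G \<and> equivclp (walk_move G) p q"

definition walk_class :: "'a pair_pre_digraph \<Rightarrow> 'a vwalk \<Rightarrow> 'a vwalk set" where
  "walk_class G p = {q. walk_equiv G p q}"

definition arrows :: "'a pair_pre_digraph \<Rightarrow> 'a \<Rightarrow> 'a \<Rightarrow> 'a vwalk set set" where
  "arrows G v w = {walk_class G p | p. vwalk p G \<and> hd p = v \<and> last p = w}"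

definition arrows_from :: "'a pair_pre_digraph \<Rightarrow> 'a \<Rightarrow> 'a vwalk set set" where
  "arrows_from G v = (\<Union>w \<in> pverts G. arrows G v w)"

text \<open>
  All walks in an arrow have the same last vertex, so \<open>last ` \<alpha>\<close> is a singleton; see
  \<open>target_walk_class\<close> below.
\<close>

definition target :: "'a vwalk set \<Rightarrow> 'a" where
  "target \<alpha> = the_elem (last ` \<alpha>)"

text \<open>
  \<open>comp_arrows G \<alpha> \<beta>\<close> is \<open>\<alpha>\<close> followed by \<open>\<beta>\<close>. It is meaningful only if the target of \<open>\<alpha>\<close> is the
  source of \<open>\<beta>\<close>; then the union collapses to a single class, see \<open>comp_arrows_walk_class\<close> below.
\<close>

definition comp_arrows :: "'a pair_pre_digraph \<Rightarrow> 'a vwalk set \<Rightarrow> 'a vwalk set \<Rightarrow> 'a vwalk set" where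
  "comp_arrows G \<alpha> \<beta> = (\<Union>p \<in> \<alpha>. \<Union>q \<in> \<beta>. walk_class G (vwalk_join p q))"

definition vertex_group :: "'a pair_pre_digraph \<Rightarrow> 'a \<Rightarrow> 'a vwalk set monoid" where
  "vertex_group G v = \<lparr>carrier = arrows G v v, monoid.mult = comp_arrows G, one = walk_class G [v]\<rparr>"

definition universal_cover :: "'a pair_pre_digraph \<Rightarrow> 'a \<Rightarrow> 'a vwalk set pair_pre_digraph" where
  "universal_cover G v =
    \<lparr>pverts = arrows_from G v,
     parcs = {(\<alpha>, \<beta>). \<alpha> \<in> arrows_from G v \<and> \<beta> \<in> arrows_from G v \<and>
       (\<exists>w x. (w, x) \<in> parcs G \<and> w = target \<alpha> \<and> \<beta> = comp_arrows G \<alpha> (walk_class G [w, x]))}\<rparr>"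

text \<open>
  Automorphisms are extensional functions (\<^const>\<open>undefined\<close> off the vertex set), as in
  \<^const>\<open>BijGroup\<close>, so that they are equal iff they agree on all vertices.
\<close>

definition graph_auts :: "'a pair_pre_digraph \<Rightarrow> ('a \<Rightarrow> 'a) set" where
  "graph_auts H = {\<phi> \<in> Bij (pverts H).
     \<forall>x \<in> pverts H. \<forall>y \<in> pverts H. (x, y) \<in> parcs H \<longleftrightarrow> (\<phi> x, \<phi> y) \<in> parcs H}"

definition deck_group :: "'a pair_pre_digraph \<Rightarrow> 'a \<Rightarrow> ('a vwalk set \<Rightarrow> 'a vwalk set) monoid" where
  "deck_group G v =
    (BijGroup (pverts (universal_cover G v)))
      \<lparr>carrier := {\<phi> \<in> graph_auts (universal_cover G v).
         \<forall>\<alpha> \<in> pverts (universal_cover G v). target (\<phi> \<alpha>) = target \<alpha>}\<rparr>"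

definition left_translation ::
  "'a pair_pre_digraph \<Rightarrow> 'a \<Rightarrow> 'a vwalk set \<Rightarrow> 'a vwalk set \<Rightarrow> 'a vwalk set" where
  "left_translation G v \<gamma> = (\<lambda>\<alpha> \<in> pverts (universal_cover G v). comp_arrows G \<gamma> \<alpha>)"


lemma walk_move_ends: "walk_move G p q \<Longrightarrow> hd p = hd q \<and> last p = last q"
  by (induction rule: walk_move.induct) (auto simp: hd_append)

lemma walk_equiv_ends:
  assumes "walk_equiv G p q" shows "hd p = hd q \<and> last p = last q"
proof -
  have "equivclp (walk_move G) p q \<Longrightarrow> hd p = hd q \<and> last p = last q"
    by (induction rule: equivclp_induct) (auto dest: walk_move_ends)
  then show ?thesis using assms by (simp add: walk_equiv_def)
qed

lemma walk_equiv_refl: "vwalk p (with_proj G) \<Longrightarrow> walk_equiv G p p"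
  by (simp add: walk_equiv_def equivclp_refl)

lemma walk_equiv_sym: "walk_equiv G p q \<Longrightarrow> walk_equiv G q p"
  by (auto simp: walk_equiv_def intro: equivclp_sym)

lemma walk_equiv_trans: "walk_equiv G p q \<Longrightarrow> walk_equiv G q r \<Longrightarrow> walk_equiv G p r"
  by (auto simp: walk_equiv_def intro: equivclp_trans)

lemma walk_class_eq: "walk_equiv G p q \<Longrightarrow> walk_class G p = walk_class G q"
  by (auto simp: walk_class_def intro: walk_equiv_trans walk_equiv_sym)

lemma target_walk_class:
  assumes "vwalk p (with_proj G)" shows "target (walk_class G p) = last p"
proof -
  have "last ` walk_class G p = {last p}"
    using walk_equiv_refl[OF assms] by (force simp: walk_class_def dest: walk_equiv_ends)
  then show ?thesis by (simp add: target_def)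
qed

lemma vwalk_arcs_join:
  "p \<noteq> [] \<Longrightarrow> q \<noteq> [] \<Longrightarrow> last p = hd q \<Longrightarrow> vwalk_arcs (p @ tl q) = vwalk_arcs p @ vwalk_arcs q"
proof (induction p rule: vwalk_arcs.induct)
  case (2 x) then show ?case by (cases q) auto
qed auto

lemma vwalk_joinI:
  assumes "vwalk p (with_proj G)" "vwalk q (with_proj G)" "last p = hd q" shows "vwalk (vwalk_join p q) (with_proj G)"
  using assms vwalk_arcs_join[of p q]
  by (auto simp: vwalk_def vwalk_join_def dest: list.set_sel(2))

lemma walk_move_vwalk:
  assumes "pair_sym_digraph G" "walk_move G p q" shows "vwalk p (with_proj G) \<and> vwalk q (with_proj G)"
  using assms(2)
proof cases
  case (prune p' a b q')
  have "vwalk (p' @ [a]) (with_proj G)" "vwalk (a # q') (with_proj G)"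
    using prune vwalk_arcs_join[of "p' @ [a]" "[a, b, a] @ q'"]
    by (auto simp: vwalk_def)
  then have "vwalk (vwalk_join (p' @ [a]) (a # q')) (with_proj G)" by (intro vwalk_joinI) auto
  then show ?thesis using prune by (simp add: vwalk_join_def)
next
  case (spider p' a b c q' b')
  have ends: "vwalk (p' @ [a]) (with_proj G)" "vwalk (c # q') (with_proj G)"
    using spider vwalk_arcs_join[of "p' @ [a]" "[a, b, c] @ q'"]
    by (auto simp: vwalk_def)
  have "b' \<in> pverts G"
    using spider assms(1) pair_wf_digraph.in_arcsD1 pair_sym_digraph_def by metis
  then have "vwalk [a, b', c] (with_proj G)" using spider by (auto simp: vwalk_def)
  then have "vwalk (vwalk_join (p' @ [a]) (vwalk_join [a, b', c] (c # q'))) (with_proj G)"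
    using ends by (intro vwalk_joinI) (auto simp: vwalk_join_def)
  then show ?thesis using spider by (simp add: vwalk_join_def)
qed

lemma walk_move_join:
  assumes G: "pair_sym_digraph G" and m: "walk_move G p q" and r: "vwalk r (with_proj G)"
  shows "last p = hd r \<Longrightarrow> walk_move G (vwalk_join p r) (vwalk_join q r)"
    and "last r = hd p \<Longrightarrow> walk_move G (vwalk_join r p) (vwalk_join r q)"
proof -
  have p: "vwalk p (with_proj G)" using walk_move_vwalk[OF G m] by simp
  show "walk_move G (vwalk_join p r) (vwalk_join q r)" if "last p = hd r"
    using m
  proof cases
    case (prune p' a b q')
    then show ?thesis
      using vwalk_joinI[OF p r that] walk_move.prune[of p' a b "q' @ tl r" G]
      by (simp add: vwalk_join_def)
  next
    case (spider p' a b c q' b')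
    then show ?thesis
      using vwalk_joinI[OF p r that] walk_move.spider[of p' a b c "q' @ tl r" G b']
      by (simp add: vwalk_join_def)
  qed
  show "walk_move G (vwalk_join r p) (vwalk_join r q)" if e: "last r = hd p"
  proof -
    obtain s z where s: "r = s @ [z]" using r by (cases r rule: rev_cases) (auto simp: vwalk_def)
    have j: "vwalk (s @ p) (with_proj G)" and q: "vwalk_join r q = s @ q"
      and jp: "vwalk_join r p = s @ p"
    proof -
      have "p \<noteq> []" "q \<noteq> []" "hd q = hd p"
        using m walk_move_ends[OF m] by (auto elim: walk_move.cases)
      then show "vwalk_join r q = s @ q" "vwalk_join r p = s @ p"
        using e s by (cases q; cases p; simp add: vwalk_join_def)+
      then show "vwalk (s @ p) (with_proj G)" using vwalk_joinI[OF r p e] by simp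
    qed
    from m show ?thesis unfolding q jp
    proof cases
      case (prune p' a b q')
      then show "walk_move G (s @ p) (s @ q)"
        using j walk_move.prune[of "s @ p'" a b q' G] by simp
    next
      case (spider p' a b c q' b')
      then show "walk_move G (s @ p) (s @ q)"
        using j walk_move.spider[of "s @ p'" a b c q' G b'] by simp
    qed
  qed
qed

lemma walk_equiv_join:
  assumes G: "pair_sym_digraph G"
    and p: "walk_equiv G p p'" and q: "walk_equiv G q q'" and e: "last p = hd q"
  shows "walk_equiv G (vwalk_join p q) (vwalk_join p' q')"
proof -
  have w: "vwalk p (with_proj G)" "vwalk q (with_proj G)" "vwalk p' (with_proj G)" "vwalk q' (with_proj G)"
    and cp: "equivclp (walk_move G) p p'" and cq: "equivclp (walk_move G) q q'"
    using p q by (auto simp: walk_equiv_def)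
  have ends: "hd q' = hd q" "last p' = last p"
    using walk_equiv_ends[OF p] walk_equiv_ends[OF q] by auto
  have "last p' = last p \<and> equivclp (walk_move G) (vwalk_join p q) (vwalk_join p' q)"
    using cp
  proof (induction rule: equivclp_induct)
    case (step y z)
    then have "last y = last z" by (auto dest: walk_move_ends)
    moreover have "walk_move G (vwalk_join y q) (vwalk_join z q) \<or>
        walk_move G (vwalk_join z q) (vwalk_join y q)"
      using step walk_move_join(1)[OF G _ w(2)] e \<open>last y = last z\<close> by auto
    ultimately show ?case
      using step.IH by (metis equivclp_into_equivclp)
  qed (simp add: equivclp_refl)
  moreover have "hd q' = hd q \<and> equivclp (walk_move G) (vwalk_join p' q) (vwalk_join p' q')"
    using cq
  proof (induction rule: equivclp_induct)
    case (step y z)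
    then have "hd y = hd z" by (auto dest: walk_move_ends)
    moreover have "walk_move G (vwalk_join p' y) (vwalk_join p' z) \<or>
        walk_move G (vwalk_join p' z) (vwalk_join p' y)"
      using step walk_move_join(2)[OF G _ w(3)] e ends \<open>hd y = hd z\<close> by auto
    ultimately show ?case
      using step.IH by (metis equivclp_into_equivclp)
  qed (simp add: equivclp_refl)
  ultimately show ?thesis
    unfolding walk_equiv_def using w e ends by (auto intro: vwalk_joinI equivclp_trans)
qed

lemma comp_arrows_walk_class:
  assumes G: "pair_sym_digraph G" and "vwalk p (with_proj G)" "vwalk q (with_proj G)" and e: "last p = hd q"
  shows "comp_arrows G (walk_class G p) (walk_class G q) = walk_class G (vwalk_join p q)"
proof -
  have "walk_class G (vwalk_join p' q') = walk_class G (vwalk_join p q)"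
    if "p' \<in> walk_class G p" "q' \<in> walk_class G q" for p' q'
    using that walk_equiv_join[OF G _ _ e, of p' q'] walk_class_eq
    by (metis mem_Collect_eq walk_class_def)
  moreover have "p \<in> walk_class G p" "q \<in> walk_class G q"
    using assms by (auto simp: walk_class_def intro: walk_equiv_refl)
  ultimately show ?thesis unfolding comp_arrows_def by blast
qed

end

theory Submission
  imports Defs
begin

text \<open>
  Left multiplication by \<open>\<gamma>\<close> commutes with right multiplication by edges, hence is a deck
  transformation; its inverse is left multiplication by \<open>\<gamma>\<inverse>\<close>. Conversely, a deck transformation
  \<open>\<phi>\<close> preserves targets and adjacency, which forces \<open>\<phi> (\<alpha> * [wx]) = \<phi> \<alpha> * [wx]\<close>: the edge of \<open>G\<close>
  under an edge of the cover is determined by the targets of its ends. Building up \<open>\<alpha>\<close> edge by edge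
  from the trivial arrow gives \<open>\<phi> \<alpha> = \<phi> [v] * \<alpha>\<close>. So the deck transformations are precisely the
  image of an injective homomorphism into the group of all permutations of the cover.
\<close>

context pair_sym_digraph
begin

section \<open>Typed arrows and the category laws of the fundamental groupoid\<close>

lemma pair_sym_digraph_G: "pair_sym_digraph G"
  by unfold_locales

lemma arrowsI: "vwalk p G \<Longrightarrow> hd p = u \<Longrightarrow> last p = w \<Longrightarrow> walk_class G p \<in> arrows G u w"
  by (auto simp: arrows_def)

lemma arrowsE:
  assumes "\<alpha> \<in> arrows G u w"
  obtains p where "vwalk p G" "hd p = u" "last p = w" "\<alpha> = walk_class G p"
  using assms by (auto simp: arrows_def)

lemma arrows_verts: "\<alpha> \<in> arrows G u w \<Longrightarrow> u \<in> pverts G \<and> w \<in> pverts G"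
  by (elim arrowsE) (auto simp: vwalk_def)

lemma target_arrow: "\<alpha> \<in> arrows G u w \<Longrightarrow> target \<alpha> = w"
  by (elim arrowsE) (simp add: target_walk_class)

text \<open>Endpoints of walks are vertices, so the union over \<open>pverts G\<close> in
  \<open>arrows_from\<close> loses nothing. This passes from membership in
  \<open>arrows_from\<close> to an arrow with known endpoints, the form in which composition is
  stated.\<close>

lemma arrows_from_iff: "\<alpha> \<in> arrows_from G u \<longleftrightarrow> \<alpha> \<in> arrows G u (target \<alpha>)"
  by (auto simp: arrows_from_def target_arrow dest: arrows_verts)

lemma arrow_in_arrows_from: "\<alpha> \<in> arrows G u w \<Longrightarrow> \<alpha> \<in> arrows_from G u"
  using target_arrow arrows_from_iff by simp

lemma trivial_arrow: "u \<in> pverts G \<Longrightarrow> walk_class G [u] \<in> arrows G u u"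
  by (rule arrowsI) (auto simp: vwalk_def)

lemma edge_arrow: "(w, x) \<in> parcs G \<Longrightarrow> walk_class G [w, x] \<in> arrows G w x"
  by (rule arrowsI) (auto simp: vwalk_def dest: in_arcsD1 in_arcsD2)

lemma vwalk_join_ends:
  "p \<noteq> [] \<Longrightarrow> q \<noteq> [] \<Longrightarrow> last p = hd q \<Longrightarrow>
    hd (vwalk_join p q) = hd p \<and> last (vwalk_join p q) = last q"
  by (cases q) (auto simp: vwalk_join_def)

lemma comp_arrows_closed:
  assumes "\<alpha> \<in> arrows G t u" "\<beta> \<in> arrows G u w"
  shows "comp_arrows G \<alpha> \<beta> \<in> arrows G t w"
proof -
  obtain p q where "vwalk p G" "hd p = t" "last p = u" "\<alpha> = walk_class G p"
    "vwalk q G" "hd q = u" "last q = w" "\<beta> = walk_class G q"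
    using assms by (meson arrowsE)
  moreover from this have "p \<noteq> []" "q \<noteq> []" by (auto simp: vwalk_def)
  ultimately show ?thesis
    using comp_arrows_walk_class[OF pair_sym_digraph_G] vwalk_join_ends[of p q]
    by (auto intro!: arrowsI vwalk_joinI)
qed

text \<open>Joining walks is associative already as an operation on nonempty lists, so the law holds
  for representatives and needs no moves.\<close>

lemma comp_arrows_assoc:
  assumes "\<alpha> \<in> arrows G s t" "\<beta> \<in> arrows G t u" "\<gamma> \<in> arrows G u w"
  shows "comp_arrows G (comp_arrows G \<alpha> \<beta>) \<gamma> = comp_arrows G \<alpha> (comp_arrows G \<beta> \<gamma>)"
proof -
  obtain p q r where w: "vwalk p G" "hd p = s" "last p = t" "\<alpha> = walk_class G p"
    "vwalk q G" "hd q = t" "last q = u" "\<beta> = walk_class G q"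
    "vwalk r G" "hd r = u" "last r = w" "\<gamma> = walk_class G r"
    using assms by (meson arrowsE)
  moreover from w have ne: "p \<noteq> []" "q \<noteq> []" "r \<noteq> []" by (auto simp: vwalk_def)
  moreover have "vwalk_join (vwalk_join p q) r = vwalk_join p (vwalk_join q r)"
    using ne by (simp add: vwalk_join_def)
  ultimately show ?thesis
    using vwalk_join_ends[of p q] vwalk_join_ends[of q r]
    by (simp add: comp_arrows_walk_class[OF pair_sym_digraph_G] vwalk_joinI)
qed

lemma comp_arrows_trivial:
  assumes "\<alpha> \<in> arrows G u w"
  shows "comp_arrows G (walk_class G [u]) \<alpha> = \<alpha>" "comp_arrows G \<alpha> (walk_class G [w]) = \<alpha>"
proof -
  obtain p where p: "vwalk p G" "hd p = u" "last p = w" "\<alpha> = walk_class G p"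
    using assms by (rule arrowsE)
  moreover from p have "p \<noteq> []" "u \<in> pverts G" "w \<in> pverts G" by (auto simp: vwalk_def)
  moreover from this have "vwalk [u] G" "vwalk [w] G" by (auto simp: vwalk_def)
  moreover have "vwalk_join [u] p = p"
    using p \<open>p \<noteq> []\<close> by (cases p) (auto simp: vwalk_join_def)
  moreover have "vwalk_join p [w] = p" by (simp add: vwalk_join_def)
  ultimately show "comp_arrows G (walk_class G [u]) \<alpha> = \<alpha>" "comp_arrows G \<alpha> (walk_class G [w]) = \<alpha>"
    using comp_arrows_walk_class[OF pair_sym_digraph_G, of "[u]" p]
      comp_arrows_walk_class[OF pair_sym_digraph_G, of p "[w]"] by auto
qed

section \<open>Reversed walks and inverse arrows\<close>

lemma vwalk_snocD: "vwalk (p @ [x]) G \<Longrightarrow> p \<noteq> [] \<Longrightarrow> vwalk p G \<and> (last p, x) \<in> parcs G"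
  \<comment> \<open>Appending \<open>x\<close> to \<open>p\<close> is joining \<open>p\<close> with
    the one-edge walk \<open>[last p, x]\<close>.\<close>
  using vwalk_arcs_join[of p "[last p, x]"] by (auto simp: vwalk_def)

lemma vwalk_rev: "vwalk p G \<Longrightarrow> vwalk (rev p) G"
proof (induction p rule: rev_induct)
  case (snoc x p)
  show ?case
  proof (cases "p = []")
    case True
    then show ?thesis using snoc.prems by simp
  next
    case False
    then have "vwalk p G" "(last p, x) \<in> parcs G" using vwalk_snocD snoc.prems by auto
    moreover from this have "(x, last p) \<in> parcs G" "x \<in> pverts G"
      by (auto intro: arcs_symmetric dest: in_arcsD2)
    ultimately show ?thesis
      using snoc.IH by (simp add: vwalk_def hd_rev)
  qed
qed simp

text \<open>A walk followed by its reverse backtracks at the middle; pruning there shortens the walk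
  by its last vertex, and induction on the walk contracts it to its starting point.\<close>

lemma walk_equiv_join_rev: "vwalk p G \<Longrightarrow> walk_equiv G (vwalk_join p (rev p)) [hd p]"
proof (induction p rule: rev_induct)
  case (snoc y p)
  show ?case
  proof (cases p rule: rev_cases)
    case Nil
    then show ?thesis using snoc.prems by (simp add: vwalk_join_def walk_equiv_refl)
  next
    case (snoc s x)
    then have "walk_equiv G (vwalk_join p (rev p)) [hd p]"
      using vwalk_snocD snoc.prems snoc.IH by blast
    moreover have w: "vwalk (vwalk_join (p @ [y]) (rev (p @ [y]))) G"
      using vwalk_joinI[OF snoc.prems vwalk_rev[OF snoc.prems]] by (simp add: hd_rev)
    \<comment> \<open>With \<open>p = s @ [x]\<close>, the joined walk is
      \<open>s @ [x, y, x] @ rev s\<close>, and pruning \<open>y\<close> leaves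
      \<open>s @ [x] @ rev s\<close>.\<close>
    then have "walk_move G (vwalk_join (p @ [y]) (rev (p @ [y]))) (vwalk_join p (rev p))"
      using walk_move.prune[of s x y "rev s" G] snoc by (simp add: vwalk_join_def)
    moreover have "hd (p @ [y]) = hd p" using snoc by (simp add: hd_append)
    ultimately show ?thesis
      using w unfolding walk_equiv_def by (metis equivclp_trans r_into_equivclp)
  qed
qed (simp add: vwalk_def)

lemma inverse_arrow:
  assumes "\<alpha> \<in> arrows G u w"
  obtains \<beta> where "\<beta> \<in> arrows G w u"
    "comp_arrows G \<alpha> \<beta> = walk_class G [u]" "comp_arrows G \<beta> \<alpha> = walk_class G [w]"
proof -
  obtain p where p: "vwalk p G" "hd p = u" "last p = w" "\<alpha> = walk_class G p"
    using assms by (rule arrowsE)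
  have r: "vwalk (rev p) G" "hd (rev p) = w" "last (rev p) = u"
    using p vwalk_rev by (auto simp: hd_rev last_rev)
  show ?thesis
  proof
    show "walk_class G (rev p) \<in> arrows G w u" using r by (intro arrowsI)
    show "comp_arrows G \<alpha> (walk_class G (rev p)) = walk_class G [u]"
      using p r walk_equiv_join_rev[of p]
      by (simp add: comp_arrows_walk_class[OF pair_sym_digraph_G] walk_class_eq)
    \<comment> \<open>The other cancellation is the same fact for \<open>rev p\<close>, whose
      reverse is \<open>p\<close>.\<close>
    show "comp_arrows G (walk_class G (rev p)) \<alpha> = walk_class G [w]"
      using p r walk_equiv_join_rev[of "rev p"]
      by (simp add: comp_arrows_walk_class[OF pair_sym_digraph_G] walk_class_eq)
  qed
qed

text \<open>A representing walk grows from \<open>[u]\<close> by appending vertices, and each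
  appended vertex multiplies the class on the right by the class of an edge.\<close>

lemma arrows_from_induct [consumes 1, case_names trivial edge]:
  assumes "\<alpha> \<in> arrows_from G u"
    and trivial: "P (walk_class G [u])"
    and edge: "\<And>\<alpha> w x. \<alpha> \<in> arrows G u w \<Longrightarrow> (w, x) \<in> parcs G \<Longrightarrow> P \<alpha> \<Longrightarrow>
      P (comp_arrows G \<alpha> (walk_class G [w, x]))"
  shows "P \<alpha>"
proof -
  have "P (walk_class G p)" if "vwalk p G" "hd p = u" for p
    using that
  proof (induction p rule: rev_induct)
    case (snoc x p)
    show ?case
    proof (cases "p = []")
      case True
      then show ?thesis using trivial snoc.prems by simp
    next
      case False
      then have p: "vwalk p G" "(last p, x) \<in> parcs G" "hd p = u"
        using vwalk_snocD snoc.prems by auto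
      moreover from this have "vwalk [last p, x] G"
        by (auto simp: vwalk_def dest: in_arcsD1 in_arcsD2)
      then have "comp_arrows G (walk_class G p) (walk_class G [last p, x]) = walk_class G (p @ [x])"
        using p comp_arrows_walk_class[OF pair_sym_digraph_G] by (simp add: vwalk_join_def)
      ultimately show ?thesis
        using edge[OF arrowsI[OF p(1) p(3) refl] p(2)] snoc.IH by simp
    qed
  qed (simp add: vwalk_def)
  then show ?thesis using assms(1) by (auto simp: arrows_from_iff elim: arrowsE)
qed

lemma group_vertex_group:
  assumes "u \<in> pverts G"
  shows "group (vertex_group G u)"
proof (rule groupI)
  fix \<alpha> assume "\<alpha> \<in> carrier (vertex_group G u)"
  then show "\<exists>\<beta> \<in> carrier (vertex_group G u).
      \<beta> \<otimes>\<^bsub>vertex_group G u\<^esub> \<alpha> = \<one>\<^bsub>vertex_group G u\<^esub>"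
    by (auto simp: vertex_group_def elim: inverse_arrow)
qed (use assms in \<open>auto simp: vertex_group_def comp_arrows_assoc
      comp_arrows_trivial intro: comp_arrows_closed trivial_arrow\<close>)

section \<open>Left translations as deck transformations\<close>

lemma pverts_universal_cover: "pverts (universal_cover G u) = arrows_from G u"
  by (simp add: universal_cover_def)

lemma universal_cover_edge_iff:
  assumes "\<alpha> \<in> arrows G u w"
  shows "(\<alpha>, \<beta>) \<in> parcs (universal_cover G u) \<longleftrightarrow>
    (\<exists>x. (w, x) \<in> parcs G \<and> \<beta> = comp_arrows G \<alpha> (walk_class G [w, x]))"
  using assms target_arrow[OF assms]
  by (auto simp: universal_cover_def
      intro: arrow_in_arrows_from comp_arrows_closed[OF _ edge_arrow])

lemma left_translation_apply:
  "\<alpha> \<in> arrows G u w \<Longrightarrow> left_translation G u \<gamma> \<alpha> = comp_arrows G \<gamma> \<alpha>"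
  by (simp add: left_translation_def pverts_universal_cover arrow_in_arrows_from)

lemma left_translation_closed:
  "\<gamma> \<in> arrows G u u \<Longrightarrow> \<alpha> \<in> arrows G u w \<Longrightarrow> left_translation G u \<gamma> \<alpha> \<in> arrows G u w"
  by (simp add: left_translation_apply comp_arrows_closed)

lemma left_translation_comp:
  assumes "\<gamma> \<in> arrows G u u" "\<delta> \<in> arrows G u u" "\<alpha> \<in> arrows G u w"
  shows "left_translation G u (comp_arrows G \<gamma> \<delta>) \<alpha> =
    left_translation G u \<gamma> (left_translation G u \<delta> \<alpha>)"
  using assms comp_arrows_closed[of \<delta> u u \<alpha> w]
  by (simp add: left_translation_apply comp_arrows_assoc)

lemma left_translation_trivial:
  "\<alpha> \<in> arrows G u w \<Longrightarrow> left_translation G u (walk_class G [u]) \<alpha> = \<alpha>"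
  by (simp add: left_translation_apply comp_arrows_trivial)

text \<open>Translation turns products of loops into composites of maps, so an inverse loop gives a
  two-sided inverse map.\<close>

lemma left_translation_inverse:
  assumes "\<gamma> \<in> arrows G u u"
  obtains \<delta> where "\<delta> \<in> arrows G u u"
    "\<And>\<alpha> w. \<alpha> \<in> arrows G u w \<Longrightarrow> left_translation G u \<gamma> (left_translation G u \<delta> \<alpha>) = \<alpha>"
    "\<And>\<alpha> w. \<alpha> \<in> arrows G u w \<Longrightarrow> left_translation G u \<delta> (left_translation G u \<gamma> \<alpha>) = \<alpha>"
proof -
  obtain \<delta> where d: "\<delta> \<in> arrows G u u"
    "comp_arrows G \<gamma> \<delta> = walk_class G [u]" "comp_arrows G \<delta> \<gamma> = walk_class G [u]"
    using assms by (rule inverse_arrow)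
  show ?thesis
    by (rule that[OF d(1)])
      (metis assms d left_translation_comp left_translation_trivial)+
qed

lemma left_translation_Bij:
  assumes g: "\<gamma> \<in> arrows G u u"
  shows "left_translation G u \<gamma> \<in> Bij (arrows_from G u)"
proof -
  obtain \<delta> where d: "\<delta> \<in> arrows G u u"
    "\<And>\<alpha> w. \<alpha> \<in> arrows G u w \<Longrightarrow> left_translation G u \<gamma> (left_translation G u \<delta> \<alpha>) = \<alpha>"
    "\<And>\<alpha> w. \<alpha> \<in> arrows G u w \<Longrightarrow> left_translation G u \<delta> (left_translation G u \<gamma> \<alpha>) = \<alpha>"
    using left_translation_inverse[OF g] by metis
  have closed: "left_translation G u \<gamma>' \<alpha> \<in> arrows_from G u"
    if "\<gamma>' \<in> arrows G u u" "\<alpha> \<in> arrows_from G u" for \<gamma>' \<alpha>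
    using that left_translation_closed arrow_in_arrows_from arrows_from_iff by metis
  have "bij_betw (left_translation G u \<gamma>) (arrows_from G u) (arrows_from G u)"
    by (rule bij_betw_byWitness[where f' = "left_translation G u \<delta>"])
      (use d g closed in \<open>auto simp: arrows_from_iff\<close>)
  then show ?thesis
    by (simp add: Bij_def left_translation_def pverts_universal_cover)
qed

text \<open>By associativity, multiplication by \<gamma> on the left commutes with multiplication by
  an edge class on the right.\<close>

lemma left_translation_edge:
  assumes g: "\<gamma> \<in> arrows G u u" and a: "\<alpha> \<in> arrows G u w"
    and e: "(\<alpha>, \<beta>) \<in> parcs (universal_cover G u)"
  shows "(left_translation G u \<gamma> \<alpha>, left_translation G u \<gamma> \<beta>) \<in> parcs (universal_cover G u)"
proof -
  obtain x where x: "(w, x) \<in> parcs G" "\<beta> = comp_arrows G \<alpha> (walk_class G [w, x])"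
    using e universal_cover_edge_iff[OF a] by auto
  then have "\<beta> \<in> arrows G u x" using a edge_arrow comp_arrows_closed by blast
  then have "left_translation G u \<gamma> \<beta> =
      comp_arrows G (left_translation G u \<gamma> \<alpha>) (walk_class G [w, x])"
    using comp_arrows_assoc[OF g a edge_arrow[OF x(1)]] a x(2)
    by (simp add: left_translation_apply)
  then show ?thesis
    using universal_cover_edge_iff[OF left_translation_closed[OF g a]] x(1) by auto
qed

lemma left_translation_deck:
  assumes g: "\<gamma> \<in> arrows G u u"
  shows "left_translation G u \<gamma> \<in> carrier (deck_group G u)"
proof -
  obtain \<delta> where d: "\<delta> \<in> arrows G u u"
    "\<And>\<alpha> w. \<alpha> \<in> arrows G u w \<Longrightarrow> left_translation G u \<delta> (left_translation G u \<gamma> \<alpha>) = \<alpha>"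
    using left_translation_inverse[OF g] by metis
  have "(\<alpha>, \<beta>) \<in> parcs (universal_cover G u) \<longleftrightarrow>
      (left_translation G u \<gamma> \<alpha>, left_translation G u \<gamma> \<beta>) \<in> parcs (universal_cover G u)"
    if "\<alpha> \<in> arrows_from G u" "\<beta> \<in> arrows_from G u" for \<alpha> \<beta>
    \<comment> \<open>Adjacency is reflected because translation by the inverse loop \<delta>
      preserves it and undoes translation by \<gamma>.\<close>
    using left_translation_edge[OF g] left_translation_edge[OF d(1) left_translation_closed[OF g]]
      d(2) that unfolding arrows_from_iff by metis
  moreover have "target (left_translation G u \<gamma> \<alpha>) = target \<alpha>" if "\<alpha> \<in> arrows_from G u" for \<alpha>
    using left_translation_closed[OF g] that target_arrow unfolding arrows_from_iff by blast
  ultimately show ?thesis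
    using left_translation_Bij[OF g]
    by (simp add: deck_group_def graph_auts_def pverts_universal_cover)
qed

section \<open>Every deck transformation is a left translation\<close>

text \<open>Adjacency alone gives \<phi>\<alpha> * [wy] for some neighbour y of w; preservation of
  targets then forces y = x.\<close>

lemma deck_edge:
  assumes \<phi>: "\<phi> \<in> carrier (deck_group G u)"
    and a: "\<alpha> \<in> arrows G u w" and e: "(w, x) \<in> parcs G"
  shows "\<phi> (comp_arrows G \<alpha> (walk_class G [w, x])) = comp_arrows G (\<phi> \<alpha>) (walk_class G [w, x])"
proof -
  let ?\<beta> = "comp_arrows G \<alpha> (walk_class G [w, x])"
  \<comment> \<open>All vertices of the cover have source \<open>u\<close>, so preserving targets
    preserves both endpoints of an arrow.\<close>
  have arrow: "\<phi> \<alpha>' \<in> arrows G u w'" if "\<alpha>' \<in> arrows G u w'" for \<alpha>' w'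
  proof -
    have "\<phi> \<alpha>' \<in> arrows_from G u" "target (\<phi> \<alpha>') = target \<alpha>'"
      using \<phi> arrow_in_arrows_from[OF that]
      by (auto simp: deck_group_def graph_auts_def pverts_universal_cover Bij_def bij_betw_def)
    then show ?thesis using target_arrow[OF that] by (simp add: arrows_from_iff)
  qed
  have b: "?\<beta> \<in> arrows G u x" using a e edge_arrow comp_arrows_closed by blast
  have "(\<alpha>, ?\<beta>) \<in> parcs (universal_cover G u)" using universal_cover_edge_iff[OF a] e by auto
  then have "(\<phi> \<alpha>, \<phi> ?\<beta>) \<in> parcs (universal_cover G u)"
    using \<phi> arrow_in_arrows_from[OF a] arrow_in_arrows_from[OF b]
    by (simp add: deck_group_def graph_auts_def pverts_universal_cover)
  then obtain y where y: "(w, y) \<in> parcs G" "\<phi> ?\<beta> = comp_arrows G (\<phi> \<alpha>) (walk_class G [w, y])"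
    using universal_cover_edge_iff[OF arrow[OF a]] by auto
  then have "\<phi> ?\<beta> \<in> arrows G u y" using arrow[OF a] edge_arrow comp_arrows_closed by simp
  then have "y = x" using arrow[OF b] target_arrow by blast
  then show ?thesis using y by simp
qed

text \<open>Both maps agree on the trivial arrow and commute with right multiplication by edges, so
  they agree by induction along walks.\<close>

lemma deck_eq_left_translation:
  assumes u: "u \<in> pverts G" and \<phi>: "\<phi> \<in> carrier (deck_group G u)"
  shows "\<phi> (walk_class G [u]) \<in> arrows G u u"
    and "\<phi> = left_translation G u (\<phi> (walk_class G [u]))"
proof -
  let ?\<gamma> = "\<phi> (walk_class G [u])"
  have "?\<gamma> \<in> arrows_from G u" "target ?\<gamma> = u"
    using \<phi> arrow_in_arrows_from[OF trivial_arrow[OF u]] target_arrow[OF trivial_arrow[OF u]]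
    by (auto simp: deck_group_def graph_auts_def pverts_universal_cover Bij_def bij_betw_def)
  then show g: "?\<gamma> \<in> arrows G u u" by (simp add: arrows_from_iff)
  have "\<phi> \<alpha> = comp_arrows G ?\<gamma> \<alpha>" if "\<alpha> \<in> arrows_from G u" for \<alpha>
    using that
  proof (induction rule: arrows_from_induct)
    case trivial
    then show ?case using comp_arrows_trivial(2)[OF g] by simp
  next
    case (edge \<alpha> w x)
    then show ?case
      using deck_edge[OF \<phi>] comp_arrows_assoc[OF g _ edge_arrow] by simp
  qed
  \<comment> \<open>Both maps are \<open>undefined\<close> off the vertices of the cover, so
    agreement on vertices gives equality of functions.\<close>
  moreover have "\<phi> \<in> extensional (arrows_from G u)"
    using \<phi> by (simp add: deck_group_def graph_auts_def pverts_universal_cover Bij_def)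
  ultimately show "\<phi> = left_translation G u ?\<gamma>"
    unfolding left_translation_def pverts_universal_cover
    by (intro extensionalityI[where A = "arrows_from G u"]) auto
qed

section \<open>The isomorphism of groups\<close>

text \<open>The codomain is the full permutation group, which is known to be a group, so that the
  group structure of \<open>deck_group\<close> can be deduced from this homomorphism.\<close>

lemma left_translation_hom_BijGroup:
  "left_translation G u \<in> hom (vertex_group G u) (BijGroup (arrows_from G u))"
proof (rule homI)
  fix \<gamma> \<delta> assume "\<gamma> \<in> carrier (vertex_group G u)" "\<delta> \<in> carrier (vertex_group G u)"
  then have gd: "\<gamma> \<in> arrows G u u" "\<delta> \<in> arrows G u u" by (auto simp: vertex_group_def)
  have "left_translation G u (comp_arrows G \<gamma> \<delta>) =
      compose (arrows_from G u) (left_translation G u \<gamma>) (left_translation G u \<delta>)"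
  proof (rule extensionalityI[where A = "arrows_from G u"])
    fix \<alpha> assume "\<alpha> \<in> arrows_from G u"
    then show "left_translation G u (comp_arrows G \<gamma> \<delta>) \<alpha> =
        compose (arrows_from G u) (left_translation G u \<gamma>) (left_translation G u \<delta>) \<alpha>"
      using left_translation_comp[OF gd] by (auto simp: compose_eq arrows_from_iff)
  qed (simp_all add: left_translation_def pverts_universal_cover)
  then show "left_translation G u (\<gamma> \<otimes>\<^bsub>vertex_group G u\<^esub> \<delta>) =
      left_translation G u \<gamma> \<otimes>\<^bsub>BijGroup (arrows_from G u)\<^esub> left_translation G u \<delta>"
    using gd left_translation_Bij by (simp add: vertex_group_def BijGroup_def)
qed (use left_translation_Bij in \<open>simp add: vertex_group_def BijGroup_def\<close>)

text \<open>The inverse map is evaluation at the trivial arrow.\<close>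

lemma left_translation_bij_betw:
  assumes u: "u \<in> pverts G"
  shows "bij_betw (left_translation G u) (arrows G u u) (carrier (deck_group G u))"
proof (rule bij_betw_byWitness[where f' = "\<lambda>\<phi>. \<phi> (walk_class G [u])"])
  show "\<forall>\<gamma> \<in> arrows G u u. left_translation G u \<gamma> (walk_class G [u]) = \<gamma>"
    using left_translation_apply[OF trivial_arrow[OF u]] comp_arrows_trivial(2) by simp
qed (use deck_eq_left_translation[OF u] left_translation_deck in auto)

end

theorem theorem3p28:
  fixes G :: "'a pair_pre_digraph" and v :: 'a
  assumes "pair_sym_digraph G"
    and "Digraph_Component.connected (with_proj G)"
    and "\<not> (\<exists>x. pverts G = {x} \<and> parcs G = {})"
    and "v \<in> pverts G"
  shows "group (vertex_group G v) \<and> group (deck_group G v) \<and>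
    (\<lambda>\<gamma>. left_translation G v \<gamma>) \<in> iso (vertex_group G v) (deck_group G v)"
proof -
  interpret pair_sym_digraph G by fact
  let ?\<Pi> = "vertex_group G v" and ?B = "BijGroup (arrows_from G v)"
  have \<Pi>: "group ?\<Pi>" using assms(4) by (rule group_vertex_group)
  interpret group_hom ?\<Pi> ?B "left_translation G v"
    using \<Pi> left_translation_hom_BijGroup
    by (simp add: group_hom_def group_hom_axioms_def group_BijGroup)
  have bij: "bij_betw (left_translation G v) (carrier ?\<Pi>) (carrier (deck_group G v))"
    using left_translation_bij_betw[OF assms(4)] by (simp add: vertex_group_def)
  have D: "deck_group G v = ?B\<lparr>carrier := carrier (deck_group G v)\<rparr>"
    by (simp add: deck_group_def pverts_universal_cover)
  \<comment> \<open>The deck transformations are the image of a group homomorphism, which yields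
    closure under composition and inverses without a direct check.\<close>
  have "subgroup (carrier (deck_group G v)) ?B"
    using img_is_subgroup bij by (simp add: bij_betw_def)
  then have "group (deck_group G v)"
    using subgroup.subgroup_is_group[OF _ group_BijGroup] D by metis
  \<comment> \<open>\<open>deck_group\<close> inherits its product from the permutation group, so
    restricting the codomain keeps the homomorphism law.\<close>
  moreover have "left_translation G v \<in> hom ?\<Pi> (deck_group G v)"
    using left_translation_hom_BijGroup[of v] bij_betwE[OF bij]
    by (subst D) (auto simp: hom_def)
  ultimately show ?thesis using \<Pi> bij by (simp add: iso_def)
qed

end
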